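(* Let $v > k \geq 2$ be integers with $v \equiv 0 \pmod{k}$. If $G$ is the incidence graph of a resolvable BIBD$(v,k,1)$, then $\sigma(G) = \frac{v}{k} + 1$.
   Context: Surrounding Cops and Robbers on a finite simple graph $G$ with $k \geq 1$ cops and one robber: the cops first choose starting vertices (several cops may share a vertex), then the robber chooses a starting vertex not occupied by a cop, and thereafter the cops and the robber alternate moves, the cops moving first. In a move, each player may move to an adjacent vertex or stay put; the robber may never move to, or remain on, a vertex occupied by a cop, so if a cop moves onto the robber's vertex the robber is compelled to move to a neighbouring vertex not occupied by a cop. The cops win if at any time every neighbour of the robber's vertex is occupied by a cop; the robber wins if he avoids this forever. Play is with perfect information. The surrounding cop number $\sigma(G)$ is the least number of cops for which the cops have a winning strategy. A BIBD$(v,k,\lambda)$ is a pair $(X,\mathcal{B})$ with $|X|=v$ and $\mathcal{B}$ a collection of $k$-subsets (blocks) of $X$ such that every 2-subset of $X$ lies in exactly $\lambda$ blocks. It is resolvable if its blocks can be partitioned into parallel classes, each parallel class being a set of blocks containing every point of $X$ exactly once. The incidence graph of $(X,\mathcal{B})$ has vertex set $X \cup \mathcal{B}$, with $x \in X$ adjacent to $B \in \mathcal{B}$ iff $x \in B$. *)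

theory Defs
  imports "Graph_Theory.Pair_Digraph" "HOL-Library.Disjoint_Sets"
begin

section \<open>Surrounding Cops and Robbers\<close>

text \<open>
  Finite simple graphs are the instances of the locale \<^locale>\<open>pair_graph\<close>: each edge is
  represented by its two opposite arcs.  The positions of the cops are given by a list, one entry
  per cop, so that several cops may share a vertex.
\<close>

definition legal_step :: "'a pair_pre_digraph \<Rightarrow> 'a \<Rightarrow> 'a \<Rightarrow> bool" where
  "legal_step G u w \<longleftrightarrow> w = u \<or> (u, w) \<in> parcs G"

definition surrounded :: "'a pair_pre_digraph \<Rightarrow> 'a list \<Rightarrow> 'a \<Rightarrow> bool" where
  "surrounded G c r \<longleftrightarrow> (\<forall>w. (r, w) \<in> parcs G \<longrightarrow> w \<in> set c)"

text \<open>
  A strategy maps the list of all robber positions so far (oldest first) to the next positions of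
  the cops; the empty history yields the starting positions.  As the cops' own earlier positions
  are determined by the strategy and the robber's earlier positions, this is perfect information.
\<close>

definition cop_strategy ::
    "'a pair_pre_digraph \<Rightarrow> nat \<Rightarrow> ('a list \<Rightarrow> 'a list) \<Rightarrow> bool" where
  "cop_strategy G m s \<longleftrightarrow>
     length (s []) = m \<and> set (s []) \<subseteq> pverts G \<and>
     (\<forall>h x. list_all2 (legal_step G) (s h) (s (h @ [x])))"

definition cops_at :: "('a list \<Rightarrow> 'a list) \<Rightarrow> (nat \<Rightarrow> 'a) \<Rightarrow> nat \<Rightarrow> 'a list" where
  "cops_at s r n = s (map r [0..<n])"

text \<open>
  The robber's positions \<open>r 0, r 1, \<dots>\<close> form an infinite play against \<open>s\<close> in which he is never
  surrounded, neither after one of his own moves (or his initial placement) nor after a move of the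
  cops.  A robber who is not surrounded after the cops' move always has a legal move, so every play
  that cannot be continued is one in which he has been surrounded.
\<close>

definition robber_evades ::
    "'a pair_pre_digraph \<Rightarrow> ('a list \<Rightarrow> 'a list) \<Rightarrow> (nat \<Rightarrow> 'a) \<Rightarrow> bool" where
  "robber_evades G s r \<longleftrightarrow>
     r 0 \<in> pverts G \<and> r 0 \<notin> set (cops_at s r 0) \<and>
     (\<forall>n. legal_step G (r n) (r (Suc n)) \<and> r (Suc n) \<notin> set (cops_at s r (Suc n))) \<and>
     (\<forall>n. \<not> surrounded G (cops_at s r n) (r n) \<and>
          \<not> surrounded G (cops_at s r (Suc n)) (r n))"

definition cops_have_winning_strategy :: "'a pair_pre_digraph \<Rightarrow> nat \<Rightarrow> bool" where
  "cops_have_winning_strategy G m \<longleftrightarrow>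
     (\<exists>s. cop_strategy G m s \<and> (\<forall>r. \<not> robber_evades G s r))"

definition surrounding_cop_number :: "'a pair_pre_digraph \<Rightarrow> nat" where
  "surrounding_cop_number G = (LEAST m. m \<ge> 1 \<and> cops_have_winning_strategy G m)"

text \<open>The minimum is taken over a nonempty set of numbers.\<close>

lemma ex_cops_have_winning_strategy:
  assumes "finite (pverts G)" "pverts G \<noteq> {}"
  shows "\<exists>m\<ge>1. cops_have_winning_strategy G m"
proof -
  obtain xs where xs: "set xs = pverts G"
    using assms finite_list by blast
  have "cop_strategy G (length xs) (\<lambda>_. xs)"
    by (auto simp: cop_strategy_def xs legal_step_def intro!: list.rel_refl)
  moreover have "\<not> robber_evades G (\<lambda>_. xs) r" for r
    by (auto simp: robber_evades_def cops_at_def xs)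
  moreover have "length xs \<ge> 1"
    using assms xs by (cases xs) auto
  ultimately show ?thesis
    unfolding cops_have_winning_strategy_def by blast
qed

section \<open>Block designs\<close>

text \<open>
  Blocks form a set, as in the vertex set of the incidence graph.  For \<open>\<lambda> = 1\<close> and \<open>k \<ge> 2\<close> this
  is no restriction, since a repeated block would put some pair of points into two blocks.
\<close>

definition bibd :: "'a set \<Rightarrow> 'a set set \<Rightarrow> nat \<Rightarrow> nat \<Rightarrow> nat \<Rightarrow> bool" where
  "bibd X \<B> v k l \<longleftrightarrow>
     finite X \<and> card X = v \<and>
     (\<forall>b\<in>\<B>. b \<subseteq> X \<and> card b = k) \<and>
     (\<forall>P. P \<subseteq> X \<and> card P = 2 \<longrightarrow> card {b \<in> \<B>. P \<subseteq> b} = l)"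

definition parallel_class :: "'a set \<Rightarrow> 'a set set \<Rightarrow> 'a set set \<Rightarrow> bool" where
  "parallel_class X \<B> C \<longleftrightarrow> C \<subseteq> \<B> \<and> (\<forall>x\<in>X. \<exists>!b. b \<in> C \<and> x \<in> b)"

definition resolvable :: "'a set \<Rightarrow> 'a set set \<Rightarrow> bool" where
  "resolvable X \<B> \<longleftrightarrow> (\<exists>R. partition_on \<B> R \<and> (\<forall>C\<in>R. parallel_class X \<B> C))"

definition incidence_graph :: "'a set \<Rightarrow> 'a set set \<Rightarrow> ('a + 'a set) pair_pre_digraph" where
  "incidence_graph X \<B> =
     \<lparr> pverts = Inl ` X \<union> Inr ` \<B>,
       parcs = {(Inl x, Inr b) | x b. x \<in> X \<and> b \<in> \<B> \<and> x \<in> b} \<union>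
               {(Inr b, Inl x) | x b. x \<in> X \<and> b \<in> \<B> \<and> x \<in> b} \<rparr>"

lemma pair_graph_incidence_graph:
  assumes "bibd X \<B> v k l"
  shows "pair_graph (incidence_graph X \<B>)"
proof -
  have fX: "finite X" and "\<B> \<subseteq> Pow X"
    using assms by (auto simp: bibd_def)
  then have fB: "finite \<B>"
    using finite_subset by blast
  let ?A = "parcs (incidence_graph X \<B>)" and ?V = "pverts (incidence_graph X \<B>)"
  have fV: "finite ?V"
    using fX fB by (simp add: incidence_graph_def)
  have sub: "?A \<subseteq> ?V \<times> ?V"
    by (auto simp: incidence_graph_def)
  have fA: "finite ?A"
    using finite_subset[OF sub] fV by blast
  have sym: "sym ?A"
    by (auto simp: incidence_graph_def sym_def)
  show ?thesis
  proof
    fix e assume e: "e \<in> ?A"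
    show "fst e \<in> ?V" "snd e \<in> ?V"
      using e sub by auto
    show "fst e \<noteq> snd e"
      using e by (auto simp: incidence_graph_def)
  qed (use fV fA sym in \<open>auto simp: symmetric_def arcs_ends_def arc_to_ends_def\<close>)
qed

end

theory Submission
  imports Defs
begin

text \<open>
  Upper bound: \<open>v div k\<close> cops stand on the blocks of a parallel class \<open>C\<close>.  Whenever the robber is on
  a block \<open>B\<close>, the points of \<open>B\<close> lie on different blocks of \<open>C\<close>, so these cops surround him at once.
  Hence he must stay on his initial point, from which the last cop drives him away in two moves.

  Lower bound: with at most \<open>v div k\<close> cops the robber stays on a point \<open>x\<close> until some cop steps
  on it.  The remaining cops can each reach at most \<open>k\<close> points in one move, so together they reach at
  most \<open>v - k\<close> points and miss some point \<open>y \<noteq> x\<close>; the robber escapes to \<open>y\<close> through the block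
  containing \<open>x\<close> and \<open>y\<close>.
\<close>

section \<open>From positions to strategies: descent for the cops, an invariant for the
  robber\<close>

section \<open>Positional criteria for winning\<close>

lemma legal_step_refl [simp]: "legal_step G u u"
  by (simp add: legal_step_def)

text \<open>Here the cops are to move, and they surround the robber within \<open>n\<close> moves.\<close>

fun cops_force :: "'a pair_pre_digraph \<Rightarrow> nat \<Rightarrow> 'a list \<Rightarrow> 'a \<Rightarrow> bool" where
  "cops_force G 0 c r = False"
| "cops_force G (Suc n) c r =
     (\<exists>c'. list_all2 (legal_step G) c c' \<and>
        (surrounded G c' r \<or>
         (\<forall>r'. legal_step G r r' \<and> r' \<notin> set c' \<longrightarrow> cops_force G n c' r')))"

declare cops_force.simps(2) [simp del]

text \<open>Always reply so that the least number of moves still needed drops; a robber evading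
  forever would give an infinite descent in the naturals.\<close>

lemma cops_have_winning_strategyI:
  assumes "length c0 = m" "set c0 \<subseteq> pverts G"
    and win: "\<And>r. r \<in> pverts G \<Longrightarrow> r \<notin> set c0 \<Longrightarrow> \<exists>n. cops_force G n c0 r"
  shows "cops_have_winning_strategy G m"
proof -
  define good where "good c r c' \<longleftrightarrow> list_all2 (legal_step G) c c' \<and>
    (surrounded G c' r \<or> (\<forall>r'. legal_step G r r' \<and> r' \<notin> set c' \<longrightarrow>
       (\<exists>n < (LEAST n. cops_force G n c r). cops_force G n c' r')))" for c r c'
  \<comment> \<open>In positions that are not won the cops stay put: \<open>cop_strategy\<close>
    demands legal moves after every history, including those that no play produces.\<close>
  define reply where
    "reply c r = (if \<exists>n. cops_force G n c r then SOME c'. good c r c' else c)" for c r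
  define s where "s = foldl reply c0"
  have good_reply: "good c r (reply c r)" if "cops_force G n c r" for n c r
  proof -
    have least: "cops_force G (LEAST n. cops_force G n c r) c r"
      using that by (rule LeastI)
    then obtain l where l: "(LEAST n. cops_force G n c r) = Suc l"
      by (cases "LEAST n. cops_force G n c r") auto
    then have "cops_force G (Suc l) c r"
      using least by simp
    then have "\<exists>c'. good c r c'"
      unfolding good_def l cops_force.simps by blast
    then have "good c r (SOME c'. good c r c')"
      by (rule someI_ex)
    then show ?thesis
      using that by (auto simp: reply_def)
  qed
  have "list_all2 (legal_step G) c (reply c r)" for c r
  proof (cases "\<exists>n. cops_force G n c r")
    case True
    then show ?thesis
      using good_reply good_def by blast
  next
    case False
    then show ?thesis
      by (auto simp: reply_def intro!: list.rel_refl)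
  qed
  then have "cop_strategy G m s"
    using assms by (simp add: cop_strategy_def s_def)
  moreover have "\<not> robber_evades G s r" for r
  proof
    assume ev: "robber_evades G s r"
    have Suc_cops: "cops_at s r (Suc i) = reply (cops_at s r i) (r i)" for i
      by (simp add: cops_at_def s_def)
    have "\<not> cops_force G n (cops_at s r i) (r i)" for n i
    proof (induction n arbitrary: i rule: less_induct)
      case (less n)
      show ?case
      proof
        assume f: "cops_force G n (cops_at s r i) (r i)"
        have "good (cops_at s r i) (r i) (cops_at s r (Suc i))"
          using good_reply[OF f] Suc_cops by simp
        then obtain j where
          j: "j < (LEAST n. cops_force G n (cops_at s r i) (r i))"
            "cops_force G j (cops_at s r (Suc i)) (r (Suc i))"
          using ev unfolding good_def robber_evades_def by blast
        have "(LEAST n. cops_force G n (cops_at s r i) (r i)) \<le> n"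
          using f by (rule Least_le)
        then show False
          using j less.IH by fastforce
      qed
    qed
    moreover have "cops_at s r 0 = c0"
      by (simp add: cops_at_def s_def)
    ultimately show False
      using ev win by (metis robber_evades_def)
  qed
  ultimately show ?thesis
    unfolding cops_have_winning_strategy_def by blast
qed

text \<open>\<open>P\<close> is an invariant of the positions with the cops to move. Dependent
  choice of the robber's answers yields an infinite play along which it persists.\<close>

lemma not_cops_have_winning_strategyI:
  assumes init: "\<And>c. length c = m \<Longrightarrow> set c \<subseteq> pverts G \<Longrightarrow>
      \<exists>r. r \<in> pverts G \<and> r \<notin> set c \<and> P c r"
    and safe: "\<And>c r. P c r \<Longrightarrow> \<not> surrounded G c r"
    and safe': "\<And>c c' r. P c r \<Longrightarrow> list_all2 (legal_step G) c c' \<Longrightarrow> \<not> surrounded G c' r"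
    and move: "\<And>c c' r. P c r \<Longrightarrow> list_all2 (legal_step G) c c' \<Longrightarrow>
      \<exists>r'. legal_step G r r' \<and> r' \<notin> set c' \<and> P c' r'"
  shows "\<not> cops_have_winning_strategy G m"
proof -
  have "\<exists>r. robber_evades G s r" if s: "cop_strategy G m s" for s
  proof -
    have step: "list_all2 (legal_step G) (s h) (s (h @ [x]))" for h x
      using s by (simp add: cop_strategy_def)
    obtain r0 where r0: "r0 \<in> pverts G" "r0 \<notin> set (s [])" "P (s []) r0"
      using init s unfolding cop_strategy_def by blast
    \<comment> \<open>The cops have not yet answered \<open>last h\<close>, so they stand at
      \<open>s (butlast h)\<close>. The clause for \<open>n = 0\<close> pins down the starting
      vertex.\<close>
    define I where "I n h \<longleftrightarrow> P (s (butlast h)) (last h) \<and> h \<noteq> [] \<and> (n = 0 \<longrightarrow> h = [r0])"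
      for n :: nat and h
    define Q where "Q h h' \<longleftrightarrow> (\<exists>x. h' = h @ [x] \<and> legal_step G (last h) x \<and> x \<notin> set (s h))"
      for h h'
    have "\<exists>h'. I (Suc n) h' \<and> Q h h'" if "I n h" for n h
    proof -
      have h: "P (s (butlast h)) (last h)" "butlast h @ [last h] = h"
        using that by (auto simp: I_def)
      then obtain x where "legal_step G (last h) x" "x \<notin> set (s h)" "P (s h) x"
        using move[OF h(1), of "s h"] step[of "butlast h" "last h"] by auto
      then have "I (Suc n) (h @ [x]) \<and> Q h (h @ [x])"
        by (simp add: I_def Q_def)
      then show ?thesis ..
    qed
    moreover have "\<exists>h. I 0 h"
      using r0 by (auto simp: I_def)
    ultimately obtain H where H: "\<And>n. I n (H n)" "\<And>n. Q (H n) (H (Suc n))"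
      using dependent_nat_choice[of I "\<lambda>_. Q"] by metis
    define r where "r n = last (H n)" for n
    have H_eq: "H n = map r [0..<Suc n]" for n
    proof (induction n)
      case 0
      then show ?case
        using H(1)[of 0] by (simp add: I_def r_def)
    next
      case (Suc n)
      obtain x where "H (Suc n) = H n @ [x]"
        using H(2)[of n] by (auto simp: Q_def)
      then show ?case
        using Suc r_def[of "Suc n"] by simp
    qed
    have P: "P (cops_at s r n) (r n)" for n
      using H(1)[of n] by (simp add: I_def H_eq cops_at_def)
    have cops: "list_all2 (legal_step G) (cops_at s r n) (cops_at s r (Suc n))" for n
      using step by (simp add: cops_at_def)
    have "r 0 = r0"
      using H(1)[of 0] by (simp add: I_def r_def)
    moreover have "legal_step G (r n) (r (Suc n)) \<and> r (Suc n) \<notin> set (cops_at s r (Suc n))" for n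
      using H(2)[of n] by (auto simp: Q_def H_eq cops_at_def)
    ultimately have "robber_evades G s r"
      using r0 safe[OF P] safe'[OF P cops] by (simp add: robber_evades_def cops_at_def[of s r 0])
    then show ?thesis
      by blast
  qed
  then show ?thesis
    unfolding cops_have_winning_strategy_def by blast
qed

section \<open>Two points determine a block, parallel classes, and moves in the incidence
  graph\<close>

section \<open>Linear spaces\<close>

text \<open>The case \<lambda> = 1 in geometric form. Existence gives routes between points;
  uniqueness makes distinct blocks meet in at most one point.\<close>

lemma bibd_ex1_block:
  assumes "bibd X \<B> v k 1" "x \<in> X" "y \<in> X" "x \<noteq> y"
  shows "\<exists>!b. b \<in> \<B> \<and> x \<in> b \<and> y \<in> b"
proof -
  have "{x, y} \<subseteq> X" "card {x, y} = 2"
    using assms by auto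
  then have "card {b \<in> \<B>. {x, y} \<subseteq> b} = 1"
    using assms(1) unfolding bibd_def by blast
  then obtain b where "{b \<in> \<B>. {x, y} \<subseteq> b} = {b}"
    using card_1_singletonE by blast
  then show ?thesis
    by blast
qed

text \<open>The class partitions \<open>X\<close> into blocks of size \<open>k\<close>; count the
  points.\<close>

lemma card_parallel_class:
  assumes "bibd X \<B> v k l" "parallel_class X \<B> C"
  shows "finite C" "k * card C = v"
proof -
  have C: "C \<subseteq> \<B>" and sub: "\<And>b. b \<in> C \<Longrightarrow> b \<subseteq> X \<and> card b = k" and fX: "finite X" "card X = v"
    using assms by (auto simp: bibd_def parallel_class_def)
  show fC: "finite C"
    using sub finite_subset[of C "Pow X"] fX by blast
  have Un: "\<Union>C = X"
    using assms sub unfolding parallel_class_def by blast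
  have "k * card C = card (\<Union>C)"
  proof (rule card_partition)
    show "finite (\<Union>C)"
      using Un fX by simp
    fix b b' assume "b \<in> C" "b' \<in> C" "b \<noteq> b'"
    then show "b \<inter> b' = {}"
      using assms sub unfolding parallel_class_def by blast
  qed (use sub fC in auto)
  then show "k * card C = v"
    using Un fX by simp
qed

lemma legal_step_incidence_graph [simp]:
  "legal_step (incidence_graph X \<B>) (Inl x) (Inl y) \<longleftrightarrow> y = x"
  "legal_step (incidence_graph X \<B>) (Inr b) (Inr b') \<longleftrightarrow> b' = b"
  "legal_step (incidence_graph X \<B>) (Inl x) (Inr b) \<longleftrightarrow> x \<in> X \<and> b \<in> \<B> \<and> x \<in> b"
  "legal_step (incidence_graph X \<B>) (Inr b) (Inl x) \<longleftrightarrow> x \<in> X \<and> b \<in> \<B> \<and> x \<in> b"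
  by (auto simp: legal_step_def incidence_graph_def)

lemma surrounded_incidence_graph:
  "surrounded (incidence_graph X \<B>) c (Inl x) \<longleftrightarrow>
     (\<forall>b\<in>\<B>. x \<in> X \<and> x \<in> b \<longrightarrow> Inr b \<in> set c)"
  "surrounded (incidence_graph X \<B>) c (Inr b) \<longleftrightarrow>
     (\<forall>x\<in>X. b \<in> \<B> \<and> x \<in> b \<longrightarrow> Inl x \<in> set c)"
  by (auto simp: surrounded_def incidence_graph_def)

section \<open>A parallel class of cops and one chaser\<close>

section \<open>Upper bound\<close>

lemma cops_force_block:
  assumes "bibd X \<B> v k 1" "parallel_class X \<B> (set Cs)" "B \<in> \<B>" "B \<notin> set Cs"
  shows "cops_force (incidence_graph X \<B>) (Suc n) (q # map Inr Cs) (Inr B)"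
proof -
  let ?G = "incidence_graph X \<B>"
  have C: "set Cs \<subseteq> \<B>" and sub: "\<And>b. b \<in> \<B> \<Longrightarrow> b \<subseteq> X"
    using assms by (auto simp: bibd_def parallel_class_def)
  \<comment> \<open>A cop whose block misses \<open>B\<close> stays; any other steps to a common
    point, which turns out to be the only one.\<close>
  define f where "f b = (if b \<inter> B = {} then Inr b else Inl (SOME y. y \<in> b \<inter> B))" for b
  have "legal_step ?G (Inr b) (f b)" if "b \<in> set Cs" for b
  proof (cases "b \<inter> B = {}")
    case False
    then have "(SOME y. y \<in> b \<inter> B) \<in> b \<inter> B"
      using some_in_eq by blast
    then show ?thesis
      using False that C sub by (auto simp: f_def)
  qed (simp add: f_def)
  then have "list_all2 (legal_step ?G) (q # map Inr Cs) (q # map f Cs)"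
    by (simp add: list_all2_map1 list_all2_map2 list.rel_refl_strong)
  moreover have "Inl y \<in> f ` set Cs" if y: "y \<in> X" "y \<in> B" for y
  proof -
    obtain b where b: "b \<in> set Cs" "y \<in> b"
      using assms(2) y unfolding parallel_class_def by blast
    \<comment> \<open>Two common points would force \<open>b = B\<close>, but \<open>B\<close> is
      outside the class.\<close>
    have "z = y" if "z \<in> b \<inter> B" for z
      using bibd_ex1_block[OF assms(1), of z y] that b y assms(3,4) C sub by blast
    then have "b \<inter> B = {y}"
      using b y by blast
    then have "f b = Inl y"
      by (simp add: f_def)
    then show ?thesis
      using b by force
  qed
  then have "surrounded ?G (q # map f Cs) (Inr B)"
    by (simp add: surrounded_incidence_graph)
  ultimately show ?thesis
    unfolding cops_force.simps by blast
qed

lemma winning_strategy_parallel_class: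
  assumes bibd: "bibd X \<B> v k 1" and pc: "parallel_class X \<B> C" and "p \<in> X"
  shows "cops_have_winning_strategy (incidence_graph X \<B>) (card C + 1)"
proof -
  let ?G = "incidence_graph X \<B>"
  obtain Cs where Cs: "set Cs = C" "distinct Cs"
    using finite_distinct_list card_parallel_class(1)[OF bibd pc] by blast
  have C: "C \<subseteq> \<B>"
    using pc by (simp add: parallel_class_def)
  have block: "cops_force ?G (Suc n) (q # map Inr Cs) (Inr B)"
    if "B \<in> \<B>" "Inr B \<notin> set (q # map Inr Cs)" for n q B
    using that pc Cs by (intro cops_force_block[OF bibd]) auto
  have stay: "list_all2 (legal_step ?G) (map Inr Cs) (map Inr Cs)"
    by (simp add: list.rel_refl)
  \<comment> \<open>The chaser steps onto \<open>x\<close>; the robber must leave for a block, where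
    the cops of the class surround him.\<close>
  have near: "cops_force ?G (Suc (Suc n)) (Inr b # map Inr Cs) (Inl x)"
    if "x \<in> X" "b \<in> \<B>" "x \<in> b" for n x b
  proof -
    have "cops_force ?G (Suc n) (Inl x # map Inr Cs) r'"
      if "legal_step ?G (Inl x) r'" "r' \<notin> set (Inl x # map Inr Cs)" for r'
      using that block by (cases r') auto
    moreover have "list_all2 (legal_step ?G) (Inr b # map Inr Cs) (Inl x # map Inr Cs)"
      using that stay by simp
    ultimately show ?thesis
      unfolding cops_force.simps(2)[of _ "Suc n"] by blast
  qed
  \<comment> \<open>The chaser goes to the block joining \<open>p\<close> and \<open>x\<close>. If
    the robber stays, \<open>near\<close> applies; if he moves to a block, he is surrounded at
    once.\<close>
  have far: "cops_force ?G (Suc (Suc (Suc n))) (Inl p # map Inr Cs) (Inl x)"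
    if x: "x \<in> X" "x \<noteq> p" for n x
  proof -
    obtain b where b: "b \<in> \<B>" "p \<in> b" "x \<in> b"
      using bibd_ex1_block[OF bibd \<open>p \<in> X\<close> x(1)] x(2) by blast
    have "cops_force ?G (Suc (Suc n)) (Inr b # map Inr Cs) r'"
      if "legal_step ?G (Inl x) r'" "r' \<notin> set (Inr b # map Inr Cs)" for r'
    proof (cases r')
      case (Inl y)
      then show ?thesis
        using that near[OF x(1) b(1,3)] by simp
    next
      case (Inr B)
      then show ?thesis
        using that block by simp
    qed
    moreover have "list_all2 (legal_step ?G) (Inl p # map Inr Cs) (Inr b # map Inr Cs)"
      using b \<open>p \<in> X\<close> stay by simp
    ultimately show ?thesis
      unfolding cops_force.simps(2)[of _ "Suc (Suc n)"] by blast
  qed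
  show ?thesis
  proof (rule cops_have_winning_strategyI)
    show "length (Inl p # map Inr Cs) = card C + 1"
      using Cs distinct_card by fastforce
    show "set (Inl p # map Inr Cs) \<subseteq> pverts ?G"
      using Cs C \<open>p \<in> X\<close> by (auto simp: incidence_graph_def)
    fix r assume r: "r \<in> pverts ?G" "r \<notin> set (Inl p # map Inr Cs)"
    show "\<exists>n. cops_force ?G n (Inl p # map Inr Cs) r"
    proof (cases r)
      case (Inl x)
      then show ?thesis
        using far[of x] r by (auto simp: incidence_graph_def)
    next
      case (Inr B)
      then show ?thesis
        using block[of B] r by (auto simp: incidence_graph_def)
    qed
  qed
qed

section \<open>Counting reachable points and the robber's invariant\<close>

section \<open>Lower bound\<close>

lemma card_UN_set_le:
  assumes "\<And>z. z \<in> set c \<Longrightarrow> card (A z) \<le> n"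
  shows "card (\<Union>z\<in>set c. A z) \<le> length c * n"
proof -
  have "card (\<Union>z\<in>set c. A z) \<le> (\<Sum>z\<in>set c. card (A z))"
    by (simp add: card_UN_le)
  also have "\<dots> \<le> card (set c) * n"
    using assms sum_bounded_above[of "set c" "\<lambda>z. card (A z)" n] by simp
  also have "\<dots> \<le> length c * n"
    by (simp add: card_length)
  finally show ?thesis .
qed

text \<open>Points are never adjacent, so the cop on \<open>x\<close> threatens no other point. The
  others reach at most \<open>v - k\<close> points in all, fewer than the \<open>v - 1\<close>
  points besides \<open>x\<close>.\<close>

lemma ex_unreachable_point:
  assumes bibd: "bibd X \<B> v k l" and "k \<ge> 2" "k * length c \<le> v" and x: "x \<in> X" "Inl x \<in> set c"
  shows "\<exists>y\<in>X. y \<noteq> x \<and> (\<forall>z\<in>set c. \<not> legal_step (incidence_graph X \<B>) z (Inl y))"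
proof (rule ccontr)
  let ?G = "incidence_graph X \<B>"
  assume neg: "\<not> ?thesis"
  define A where "A z = {y \<in> X - {x}. legal_step ?G z (Inl y)}" for z
  have fX: "finite X" "card X = v"
    using bibd by (auto simp: bibd_def)
  \<comment> \<open>Only one cop on \<open>x\<close> is discarded; any further ones just weaken the
    bound.\<close>
  define d where "d = remove1 (Inl x) c"
  have d: "length d = length c - 1" "length c \<ge> 1"
    using x by (auto simp: d_def length_remove1 Suc_le_eq length_pos_if_in_set)
  have "card (A z) \<le> k" for z
  proof (cases z)
    case (Inl y)
    then have "A z \<subseteq> {y}"
      by (auto simp: A_def)
    then have "card (A z) \<le> 1"
      using card_mono[of "{y}" "A z"] by simp
    then show ?thesis
      using \<open>k \<ge> 2\<close> by simp
  next
    case (Inr b)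
    show ?thesis
    proof (cases "b \<in> \<B>")
      case True
      then have b: "b \<subseteq> X" "card b = k"
        using bibd by (auto simp: bibd_def)
      have "A z \<subseteq> b"
        using Inr by (auto simp: A_def)
      then show ?thesis
        using b fX card_mono[of b "A z"] finite_subset by blast
    next
      case False
      then have "A z = {}"
        using Inr by (auto simp: A_def)
      then show ?thesis
        by simp
    qed
  qed
  then have "card (\<Union>z\<in>set d. A z) \<le> length d * k"
    by (rule card_UN_set_le)
  moreover have "X - {x} \<subseteq> (\<Union>z\<in>set d. A z)"
  proof
    fix y assume y: "y \<in> X - {x}"
    then obtain z where z: "z \<in> set c" "legal_step ?G z (Inl y)"
      using neg by blast
    then have "z \<noteq> Inl x"
      using y by auto
    then have "z \<in> set d"
      using z by (simp add: d_def)
    then show "y \<in> (\<Union>z\<in>set d. A z)"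
      using z y by (auto simp: A_def)
  qed
  then have "card (X - {x}) \<le> card (\<Union>z\<in>set d. A z)"
    using fX by (intro card_mono) (auto simp: A_def)
  ultimately have "v - 1 \<le> length d * k"
    using x fX by simp
  moreover have "length d * k + k \<le> v"
    using d assms(3) by (cases "length c") (auto simp: algebra_simps)
  ultimately show False
    using \<open>k \<ge> 2\<close> by linarith
qed

text \<open>Surrounding \<open>x\<close> takes a cop on every block through \<open>x\<close>. These
  blocks cover the other \<open>v - 1\<close> points, each block only \<open>k - 1\<close> of them,
  which needs too many cops.\<close>

lemma point_not_surrounded:
  assumes bibd: "bibd X \<B> v k 1" and "k < v" "k \<ge> 2" "k * length c \<le> v" and x: "x \<in> X"
  shows "\<not> surrounded (incidence_graph X \<B>) c (Inl x)"
proof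
  assume sur: "surrounded (incidence_graph X \<B>) c (Inl x)"
  define A where "A z = {y. \<exists>b\<in>\<B>. z = Inr b \<and> x \<in> b \<and> y \<in> b - {x}}" for z :: "'a + 'a set"
  have fX: "finite X" "card X = v"
    using bibd by (auto simp: bibd_def)
  have "card (A z) \<le> k - 1" for z
  proof (cases "\<exists>b\<in>\<B>. z = Inr b \<and> x \<in> b")
    case True
    then obtain b where b: "b \<in> \<B>" "z = Inr b" "x \<in> b"
      by blast
    then have "A z = b - {x}"
      by (auto simp: A_def)
    moreover have "card b = k"
      using b bibd by (auto simp: bibd_def)
    ultimately show ?thesis
      using b by simp
  next
    case False
    then have "A z = {}"
      by (auto simp: A_def)
    then show ?thesis
      by simp
  qed
  then have "card (\<Union>z\<in>set c. A z) \<le> length c * (k - 1)"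
    by (rule card_UN_set_le)
  moreover have "X - {x} \<subseteq> (\<Union>z\<in>set c. A z)"
  proof
    fix y assume y: "y \<in> X - {x}"
    then obtain b where b: "b \<in> \<B>" "x \<in> b" "y \<in> b"
      using bibd_ex1_block[OF bibd x, of y] by blast
    then have "Inr b \<in> set c"
      using sur x by (auto simp: surrounded_incidence_graph)
    then show "y \<in> (\<Union>z\<in>set c. A z)"
      using b y by (auto simp: A_def)
  qed
  moreover have "(\<Union>z\<in>set c. A z) \<subseteq> X"
    using bibd by (auto simp: A_def bibd_def)
  ultimately have "card (X - {x}) \<le> length c * (k - 1)"
    using fX by (meson card_mono finite_subset le_trans)
  then have le: "v - 1 \<le> length c * (k - 1)"
    using x fX by simp
  \<comment> \<open>Together with \<open>k * length c \<le> v\<close> this leaves at most one cop,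
    whose block covers only \<open>k - 1 < v - 1\<close> other points.\<close>
  have "k * length c = length c * (k - 1) + length c"
    using \<open>k \<ge> 2\<close> by (cases k) (auto simp: algebra_simps)
  then have "length c \<le> 1"
    using le assms(4) \<open>k < v\<close> by linarith
  then have "length c * (k - 1) \<le> k - 1"
    by (cases "length c") auto
  then show False
    using le \<open>k < v\<close> \<open>k \<ge> 2\<close> by linarith
qed

lemma no_winning_strategy_few_cops:
  assumes bibd: "bibd X \<B> v k 1" and "k < v" "k \<ge> 2" and m: "k * m \<le> v"
  shows "\<not> cops_have_winning_strategy (incidence_graph X \<B>) m"
proof -
  let ?G = "incidence_graph X \<B>"
  \<comment> \<open>The robber is on a point, or in transit on a block with a destination
    \<open>y\<close> that no cop can reach in the coming move. Hence \<open>y\<close> stays free,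
    and he is neither surrounded nor stuck.\<close>
  define P where "P c r \<longleftrightarrow> length c = m \<and>
    ((\<exists>x\<in>X. r = Inl x) \<or>
     (\<exists>b\<in>\<B>. \<exists>y\<in>X. y \<in> b \<and> r = Inr b \<and> (\<forall>z\<in>set c. \<not> legal_step ?G z (Inl y))))" for c r
  have fX: "finite X" "card X = v"
    using bibd by (auto simp: bibd_def)
  have safe': "\<not> surrounded ?G c' r" if P: "P c r" and mv: "list_all2 (legal_step ?G) c c'" for c c' r
  proof (cases r)
    case (Inl x)
    then show ?thesis
      using P point_not_surrounded[OF assms(1-3)] m list_all2_lengthD[OF mv] by (auto simp: P_def)
  next
    case (Inr b)
    then obtain y where y: "b \<in> \<B>" "y \<in> X" "y \<in> b" "\<forall>z\<in>set c. \<not> legal_step ?G z (Inl y)"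
      using P by (auto simp: P_def)
    have "Inl y \<notin> set c'"
      using mv y(4) by (metis in_set_conv_nth list_all2_conv_all_nth)
    then show ?thesis
      using y Inr by (auto simp: surrounded_incidence_graph)
  qed
  show ?thesis
  proof (rule not_cops_have_winning_strategyI[where P = P])
    fix c :: "('a + 'a set) list" assume c: "length c = m"
    have "card (set c) < card (Inl ` X :: ('a + 'a set) set)"
    proof -
      \<comment> \<open>Fewer cops than points, so some point is free at the start.\<close>
      have "2 * m \<le> k * m"
        using \<open>k \<ge> 2\<close> by simp
      then have "m < v"
        using m \<open>k < v\<close> by linarith
      then show ?thesis
        using c card_length[of c] fX by (simp add: card_image)
    qed
    then obtain x where "x \<in> X" "Inl x \<notin> set c"
      using card_mono[OF finite_set, of "Inl ` X" c] by force
    then show "\<exists>r. r \<in> pverts ?G \<and> r \<notin> set c \<and> P c r"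
      using c by (auto simp: P_def incidence_graph_def)
  next
    fix c r assume "P c r"
    \<comment> \<open>Staying put is a legal move of the cops.\<close>
    then show "\<not> surrounded ?G c r"
      using safe' by (simp add: list.rel_refl)
  next
    fix c c' r assume P: "P c r" and mv: "list_all2 (legal_step ?G) c c'"
    then show "\<not> surrounded ?G c' r"
      by (rule safe')
    have len: "length c' = m"
      using P list_all2_lengthD[OF mv] by (simp add: P_def)
    show "\<exists>r'. legal_step ?G r r' \<and> r' \<notin> set c' \<and> P c' r'"
    proof (cases r)
      case (Inl x)
      then have x: "x \<in> X"
        using P by (auto simp: P_def)
      show ?thesis
      proof (cases "Inl x \<in> set c'")
        case True
        then obtain y where y: "y \<in> X" "y \<noteq> x" "\<forall>z\<in>set c'. \<not> legal_step ?G z (Inl y)"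
          using ex_unreachable_point[OF bibd \<open>k \<ge> 2\<close> _ x] m len by auto
        then obtain b where b: "b \<in> \<B>" "x \<in> b" "y \<in> b"
          using bibd_ex1_block[OF bibd x, of y] by blast
        \<comment> \<open>A cop on \<open>b\<close> could step to \<open>y\<close>, against the
          choice of \<open>y\<close>.\<close>
        then have "Inr b \<notin> set c'"
          using y by fastforce
        moreover have "P c' (Inr b)"
          using b y len by (auto simp: P_def)
        ultimately show ?thesis
          using Inl x b by (intro exI[of _ "Inr b"]) simp
      next
        case False
        then show ?thesis
          using Inl x len by (intro exI[of _ r]) (simp add: P_def)
      qed
    next
      case (Inr b)
      then obtain y where y: "b \<in> \<B>" "y \<in> X" "y \<in> b" "\<forall>z\<in>set c. \<not> legal_step ?G z (Inl y)"
        using P by (auto simp: P_def)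
      have "Inl y \<notin> set c'"
        using mv y(4) by (metis in_set_conv_nth list_all2_conv_all_nth)
      then show ?thesis
        using Inr y len by (intro exI[of _ "Inl y"]) (simp add: P_def)
    qed
  qed
qed

theorem theorem24:
  fixes X :: "'a set" and \<B> :: "'a set set" and v k :: nat
  assumes "v > k" and "k \<ge> 2" and "v mod k = 0"
    and "bibd X \<B> v k 1" and "resolvable X \<B>"
  shows "surrounding_cop_number (incidence_graph X \<B>) = v div k + 1"
proof -
  have fX: "finite X" "card X = v"
    using assms(4) by (auto simp: bibd_def)
  then have "\<not> card X \<le> 1"
    using assms by simp
  then obtain p q where pq: "p \<in> X" "q \<in> X" "p \<noteq> q"
    using card_le_Suc0_iff_eq[OF fX(1)] by auto
  \<comment> \<open>The resolution of an empty set of blocks would contain no class; a block through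
    two points rules this out.\<close>
  then have "\<B> \<noteq> {}"
    using bibd_ex1_block[OF assms(4)] by blast
  then obtain C where C: "parallel_class X \<B> C"
    using assms(5) unfolding resolvable_def partition_on_def by blast
  have card: "card C = v div k"
    using card_parallel_class(2)[OF assms(4) C] assms(2) by auto
  show ?thesis
    unfolding surrounding_cop_number_def
  proof (rule Least_equality)
    show "1 \<le> v div k + 1 \<and> cops_have_winning_strategy (incidence_graph X \<B>) (v div k + 1)"
      using winning_strategy_parallel_class[OF assms(4) C pq(1)] card by simp
    fix m assume m: "1 \<le> m \<and> cops_have_winning_strategy (incidence_graph X \<B>) m"
    show "v div k + 1 \<le> m"
    proof (rule ccontr)
      assume "\<not> v div k + 1 \<le> m"
      then have "k * m \<le> k * (v div k)"
        by simp
      also have "\<dots> \<le> v"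
        by simp
      finally show False
        using no_winning_strategy_few_cops[OF assms(4,1,2)] m by blast
    qed
  qed
qed

end
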